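(* The set $\mathrm{Out}(\omega,n)$ is a cofinite subset of $\mathbb{N}$ for every $n\in\mathbb{N}$. More precisely, for every $n\in\mathbb{N}$, $$\mathrm{Out}(\omega,n)=\{u\in\mathbb{N} \mid u\geq \omega(n)\}.$$ Consequently, $\mathrm{Out}(\omega,n)=\mathbb{N}$ if and only if $n=p^k$ for some prime $p$ and integer $k\geq 0$.
   Context: $\mathbb{N}$ denotes the set of positive integers. For $m\in\mathbb{N}$, $\omega(m)$ is the number of distinct prime divisors of $m$ (so $\omega(1)=0$). For an arithmetic function $g$ and $n\in\mathbb{N}$, $\mathrm{Out}(g,n)$ is the set of all $u\in\mathbb{N}$ for which there exists a positive integer $N$ such that $n\mid N$ and $g(N)=u$. A subset of $\mathbb{N}$ is cofinite if its complement in $\mathbb{N}$ is finite. *)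

theory Defs
  imports "HOL-Computational_Algebra.Primes"
begin

text \<open>
  The positive integers are the set \<open>{1..}\<close> of type \<^typ>\<open>nat set\<close>. Arithmetic functions are
  functions on \<^typ>\<open>nat\<close> whose value at \<open>0\<close> is irrelevant.
\<close>

definition omega :: "nat \<Rightarrow> nat" where
  "omega m = card (prime_factors m)"

definition Out :: "(nat \<Rightarrow> nat) \<Rightarrow> nat \<Rightarrow> nat set" where
  "Out g n = {u \<in> {1..}. \<exists>N\<in>{1..}. n dvd N \<and> g N = u}"

definition cofinite_subset :: "'a set \<Rightarrow> 'a set \<Rightarrow> bool" where
  "cofinite_subset S A \<longleftrightarrow> S \<subseteq> A \<and> finite (A - S)"

end

theory Submission
  imports Defs
begin

text \<open>A multiple of \<open>n\<close> inherits all prime factors of \<open>n\<close>, so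
  \<open>omega n\<close> is a lower bound for the values on multiples (\<open>omega_mono\<close>).
  Conversely, multiplying by a prime that does not yet divide raises \<open>omega\<close> by exactly
  one, and such a prime always exists; starting from \<open>n\<close> itself, every value from
  \<open>omega n\<close> upwards is reached (\<open>exists_multiple_omega_eq\<close>). Only finitely
  many positive integers lie below \<open>omega n\<close>, whence cofiniteness, and none do exactly
  when \<open>omega n \<le> 1\<close>, which characterises prime powers
  (\<open>omega_le_1_iff\<close>).\<close>

lemma omega_mono:
  assumes "n dvd N" "N \<noteq> 0"
  shows "omega n \<le> omega N"
  unfolding omega_def using assms by (intro card_mono dvd_prime_factors) auto

lemma omega_mult_new_prime:
  assumes "n \<noteq> 0" "prime p" "\<not> p dvd n"
  shows "omega (n * p) = Suc (omega n)"
proof -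
  have "prime_factors (n * p) = insert p (prime_factors n)"
    using assms by (auto simp: prime_factors_product prime_prime_factors)
  then show ?thesis
    using assms(3) by (simp add: omega_def in_prime_factors_iff)
qed

text \<open>A prime larger than \<open>n\<close> cannot divide the positive number
  \<open>n\<close>.\<close>

lemma exists_prime_not_dvd:
  assumes "n > (0::nat)"
  shows "\<exists>p. prime p \<and> \<not> p dvd n"
  using bigger_prime[of n] assms by (meson dvd_imp_le not_le)

lemma exists_multiple_omega_eq:
  assumes "n > 0" "omega n \<le> u"
  shows "\<exists>N>0. n dvd N \<and> omega N = u"
  using assms(2)
\<comment> \<open>The induction starts at \<open>omega n\<close>, with \<open>N = n\<close> as
  witness; each step multiplies the current witness by a fresh prime.\<close>
proof (induction u rule: dec_induct)
  case base
  then show ?case using assms(1) by (intro exI[of _ n]) simp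
next
  case (step u)
  then obtain N where N: "N > 0" "n dvd N" "omega N = u" by (elim exE conjE)
  obtain p where p: "prime p" "\<not> p dvd N"
    using exists_prime_not_dvd[OF N(1)] by blast
  have "N * p > 0" "n dvd N * p"
    using N p(1) by (simp_all add: prime_gt_0_nat)
  moreover have "omega (N * p) = Suc u"
    using N p omega_mult_new_prime[of N p] by simp
  ultimately show ?case by (intro exI[of _ "N * p"] conjI)
qed

lemma Out_omega_eq:
  assumes "n \<ge> 1"
  shows "Out omega n = {u \<in> {1..}. u \<ge> omega n}"
proof (intro equalityI subsetI)
  fix u assume "u \<in> Out omega n"
  then obtain N where "N \<ge> 1" "n dvd N" "u = omega N" "u \<ge> 1"
    unfolding Out_def by force
  then show "u \<in> {u \<in> {1..}. u \<ge> omega n}"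
    using omega_mono[of n N] by simp
next
  fix u assume u: "u \<in> {u \<in> {1..}. u \<ge> omega n}"
  then obtain N where "N > 0" "n dvd N" "omega N = u"
    using exists_multiple_omega_eq[of n u] assms by force
  then have "\<exists>N\<in>{1..}. n dvd N \<and> omega N = u"
    by (intro bexI[of _ N]) simp_all
  then show "u \<in> Out omega n"
    using u by (simp add: Out_def)
qed

lemma omega_le_1_iff:
  assumes "n \<ge> 1"
  shows "omega n \<le> 1 \<longleftrightarrow> (\<exists>p k::nat. prime p \<and> n = p ^ k)"
proof
  assume "omega n \<le> 1"
  then consider "prime_factors n = {}" | p where "prime_factors n = {p}"
    by (auto simp: omega_def le_Suc_eq card_1_singleton_iff)
  then show "\<exists>p k::nat. prime p \<and> n = p ^ k"
  proof cases
    case 1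
    then have "n = 2 ^ 0"
      using assms by (simp add: prime_factorization_empty_iff)
    then show ?thesis using two_is_prime_nat by blast
  next
    case (2 p)
    have "n = (\<Prod>q\<in>prime_factors n. q ^ multiplicity q n)"
      using assms by (intro prime_factorization_nat) simp
    also have "\<dots> = p ^ multiplicity p n"
      unfolding 2 by simp
    finally have "n = p ^ multiplicity p n" .
    moreover have "prime p"
      using 2 in_prime_factors_imp_prime[of p n] by simp
    ultimately show ?thesis by (intro exI conjI)
  qed
next
  assume "\<exists>p k::nat. prime p \<and> n = p ^ k"
  then obtain p k where "prime p" "n = p ^ k" by blast
  \<comment> \<open>Only an inclusion, since \<open>k = 0\<close> leaves no prime factor.\<close>
  then have "prime_factors n \<subseteq> {p}"
    using prime_dvd_power primes_dvd_imp_eq by blast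
  then show "omega n \<le> 1"
    using card_mono[of "{p}" "prime_factors n"] by (simp add: omega_def)
qed

theorem theorem8:
  shows "(\<forall>n\<in>{1::nat..}. cofinite_subset (Out omega n) {1..}) \<and>
    (\<forall>n\<in>{1::nat..}. Out omega n = {u \<in> {1..}. u \<ge> omega n}) \<and>
    (\<forall>n\<in>{1::nat..}. Out omega n = {1..} \<longleftrightarrow> (\<exists>p k::nat. prime p \<and> n = p ^ k))"
proof (intro conjI ballI)
  fix n :: nat assume "n \<in> {1..}"
  then have n: "n \<ge> 1" by simp
  show eq: "Out omega n = {u \<in> {1..}. u \<ge> omega n}"
    by (rule Out_omega_eq[OF n])
  have "{1..} - Out omega n \<subseteq> {..<omega n}"
    by (auto simp: eq)
  then have "finite ({1..} - Out omega n)"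
    by (rule finite_subset) simp
  then show "cofinite_subset (Out omega n) {1..}"
    by (auto simp: cofinite_subset_def eq)
  \<comment> \<open>The least candidate \<open>u = 1\<close> decides: it is attained iff
    \<open>omega n \<le> 1\<close>, and then so is every larger value. As 0 is excluded from
    \<open>Out\<close>, the cases \<open>omega n = 0\<close> and \<open>omega n = 1\<close> give the
    same set.\<close>
  have "Out omega n = {1..} \<longleftrightarrow> omega n \<le> 1"
    unfolding eq by fastforce
  then show "Out omega n = {1..} \<longleftrightarrow> (\<exists>p k::nat. prime p \<and> n = p ^ k)"
    by (simp only: omega_le_1_iff[OF n])
qed

end
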